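(* Let $T$ be the bipartite digraph with parts $A_1,A_2$, $|A_1|=|A_2|=3$, obtained from the complete bipartite digraph $\vec K_{3,3}$ (all arcs directed from $A_1$ to $A_2$) by deleting a perfect matching (so $T$ is an alternately oriented $6$-cycle). Let $D$ be the digraph with vertex set $\mathbb{Z}\times A_1\times A_2$ in which there is an arc from $(i,a_1,a_2)$ to $(i+1,b_1,b_2)$ if and only if $(a_1,b_2)\in E(T)$, and there are no other arcs. Then $D$ is a connected highly arc-transitive digraph for which there exists a homomorphism $f:D\to Z$ with $f^{-1}(0)$ finite, but $R(D)$ is not a complete bipartite digraph. Consequently, the following conjecture of Cameron, Praeger and Wormald is false: if $D$ is a connected highly arc-transitive digraph such that there exists a homomorphism $f:D\to Z$ with $f^{-1}(0)$ finite, then $R(D)$ is a complete bipartite digraph.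
   Context: A digraph $D$ consists of a vertex set $V(D)$ and an arc set $E(D)\subseteq V(D)\times V(D)$, without loops. Connected means that the underlying undirected graph is connected. For $s\ge 0$, an $s$-arc in $D$ is an $(s+1)$-tuple $(v_0,\dots,v_s)$ of vertices such that $v_{i-1}v_i\in E(D)$ for each $i=1,\dots,s$. $D$ is $s$-arc transitive if $D$ has no isolated vertices, every arc of $D$ lies on some $s$-arc (for $s\ge1$), and for any two $s$-arcs $(v_i)_{i=0}^s$, $(v_i')_{i=0}^s$ there is an automorphism $f$ of $D$ with $f(v_i)=v_i'$ for all $i$. $D$ is highly arc-transitive if it is $s$-arc transitive for every $s\ge 0$. $Z$ denotes the two-way-infinite directed path, with vertex set $\mathbb{Z}$ and arcs $(i,i+1)$; a homomorphism $f:D\to Z$ is a map $f:V(D)\to\mathbb{Z}$ with $f(v)=f(u)+1$ for every arc $uv$ of $D$. An alternating walk in $D$ is a sequence $(v_0,\dots,v_s)$ of vertices such that, either for all even $i$ or for all odd $i$, $v_iv_{i+1}$ and $v_iv_{i-1}$ are arcs of $D$ (whenever the indices lie in $\{0,\dots,s\}$). For arcs $e,e'$, write $e\sim e'$ if there is an alternating walk whose first arc is $e$ and whose last arc is $e'$; this is an equivalence relation on $E(D)$. If $D$ is $1$-arc transitive, the digraphs formed by the arcs of one equivalence class together with their end-vertices are all isomorphic to a fixed digraph, denoted $R(D)$. A complete bipartite digraph $\vec K_{m,n}$ has vertex set a disjoint union $X\cup Y$ with $|X|=m$, $|Y|=n$, and arc set $X\times Y$. *)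

theory Defs
  imports
    "Graph_Theory.Digraph_Component"
    "Graph_Theory.Digraph_Isomorphism"
begin

text \<open>
  Digraphs are records of type \<open>'v pair_pre_digraph\<close> (a vertex set and a set of ordered pairs,
  both possibly infinite) satisfying the locale predicate \<open>pair_loopfree_digraph\<close>.
\<close>

section \<open>Arc-transitivity\<close>

definition s_arc :: "'v pair_pre_digraph \<Rightarrow> nat \<Rightarrow> 'v list \<Rightarrow> bool" where
  "s_arc D s p \<longleftrightarrow> length p = s + 1 \<and> set p \<subseteq> pverts D \<and>
     (\<forall>i\<in>{1..s}. (p ! (i - 1), p ! i) \<in> parcs D)"

definition automorphism :: "'v pair_pre_digraph \<Rightarrow> ('v \<Rightarrow> 'v) \<Rightarrow> bool" where
  "automorphism D f \<longleftrightarrow> bij_betw f (pverts D) (pverts D) \<and>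
     (\<forall>u\<in>pverts D. \<forall>v\<in>pverts D. (u, v) \<in> parcs D \<longleftrightarrow> (f u, f v) \<in> parcs D)"

definition no_isolated_vertices :: "'v pair_pre_digraph \<Rightarrow> bool" where
  "no_isolated_vertices D \<longleftrightarrow>
     (\<forall>v\<in>pverts D. \<exists>u\<in>pverts D. (u, v) \<in> parcs D \<or> (v, u) \<in> parcs D)"

definition s_arc_transitive :: "'v pair_pre_digraph \<Rightarrow> nat \<Rightarrow> bool" where
  "s_arc_transitive D s \<longleftrightarrow>
     no_isolated_vertices D \<and>
     (s \<ge> 1 \<longrightarrow>
       (\<forall>e\<in>parcs D. \<exists>p. s_arc D s p \<and> (\<exists>i\<in>{1..s}. e = (p ! (i - 1), p ! i)))) \<and>
     (\<forall>p q. s_arc D s p \<and> s_arc D s q \<longrightarrow> (\<exists>f. automorphism D f \<and> map f p = q))"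

definition highly_arc_transitive :: "'v pair_pre_digraph \<Rightarrow> bool" where
  "highly_arc_transitive D \<longleftrightarrow> (\<forall>s. s_arc_transitive D s)"


section \<open>Homomorphisms to the two-way-infinite directed path\<close>

definition digraph_hom ::
    "('v \<Rightarrow> 'w) \<Rightarrow> 'v pair_pre_digraph \<Rightarrow> 'w pair_pre_digraph \<Rightarrow> bool" where
  "digraph_hom f D E \<longleftrightarrow> f ` pverts D \<subseteq> pverts E \<and>
     (\<forall>u v. (u, v) \<in> parcs D \<longrightarrow> (f u, f v) \<in> parcs E)"

definition directed_line :: "int pair_pre_digraph" where
  "directed_line = \<lparr>pverts = UNIV, parcs = {(i, i + 1) | i. True}\<rparr>"

lemma digraph_hom_directed_line_iff:
  "digraph_hom f D directed_line \<longleftrightarrow> (\<forall>u v. (u, v) \<in> parcs D \<longrightarrow> f v = f u + 1)"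
  by (auto simp: digraph_hom_def directed_line_def)


section \<open>Alternating walks and the digraph \<open>R(D)\<close>\<close>

text \<open>
  The flag \<open>b\<close> selects which of the two alternatives in the definition of an alternating walk
  holds: arcs leave the vertices at even positions (\<open>b = True\<close>) or at odd positions
  (\<open>b = False\<close>). It is kept explicit because in a digraph with 2-cycles the vertex
  sequence alone does not determine the arcs of the walk.
\<close>

definition alternating_walk :: "'v pair_pre_digraph \<Rightarrow> bool \<Rightarrow> 'v list \<Rightarrow> bool" where
  "alternating_walk D b p \<longleftrightarrow> p \<noteq> [] \<and> set p \<subseteq> pverts D \<and>
     (\<forall>i<length p. even i = b \<longrightarrow>
        (i + 1 < length p \<longrightarrow> (p ! i, p ! (i + 1)) \<in> parcs D) \<and>
        (i \<ge> 1 \<longrightarrow> (p ! i, p ! (i - 1)) \<in> parcs D))"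

text \<open>The arc of the walk that joins positions \<open>j\<close> and \<open>j + 1\<close>.\<close>

definition walk_arc :: "bool \<Rightarrow> 'v list \<Rightarrow> nat \<Rightarrow> 'v \<times> 'v" where
  "walk_arc b p j = (if even j = b then (p ! j, p ! (j + 1)) else (p ! (j + 1), p ! j))"

definition alternating_related ::
    "'v pair_pre_digraph \<Rightarrow> 'v \<times> 'v \<Rightarrow> 'v \<times> 'v \<Rightarrow> bool" where
  "alternating_related D e e' \<longleftrightarrow>
     (\<exists>b p. alternating_walk D b p \<and> length p \<ge> 2 \<and>
        walk_arc b p 0 = e \<and> walk_arc b p (length p - 2) = e')"

definition alternating_class :: "'v pair_pre_digraph \<Rightarrow> 'v \<times> 'v \<Rightarrow> ('v \<times> 'v) set" where
  "alternating_class D e = {e' \<in> parcs D. alternating_related D e e'}"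

definition digraph_of_arcs :: "('v \<times> 'v) set \<Rightarrow> 'v pair_pre_digraph" where
  "digraph_of_arcs C = \<lparr>pverts = fst ` C \<union> snd ` C, parcs = C\<rparr>"

text \<open>
  \<open>R(D)\<close> is only defined up to isomorphism, for 1-arc transitive \<open>D\<close>. It is represented by the
  digraph of the class of one chosen arc; \<open>reachability_digraph_iso\<close> below shows that for
  1-arc transitive \<open>D\<close> every other class gives an isomorphic digraph.
\<close>

definition reachability_digraph :: "'v pair_pre_digraph \<Rightarrow> 'v pair_pre_digraph" where
  "reachability_digraph D = digraph_of_arcs (alternating_class D (SOME e. e \<in> parcs D))"

lemma automorphism_inv:
  assumes "automorphism D f"
  shows "automorphism D (inv_into (pverts D) f)"
proof -
  have b: "bij_betw f (pverts D) (pverts D)" using assms by (simp add: automorphism_def)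
  let ?g = "inv_into (pverts D) f"
  have gb: "bij_betw ?g (pverts D) (pverts D)" using b by (rule bij_betw_inv_into)
  have gin: "?g v \<in> pverts D" and fg: "f (?g v) = v" if "v \<in> pverts D" for v
    using that gb bij_betw_inv_into_right[OF b] by (auto simp: bij_betw_def)
  have "(u, v) \<in> parcs D \<longleftrightarrow> (?g u, ?g v) \<in> parcs D"
    if "u \<in> pverts D" "v \<in> pverts D" for u v
    using assms gin[OF that(1)] gin[OF that(2)] fg[OF that(1)] fg[OF that(2)]
    unfolding automorphism_def by metis
  with gb show ?thesis by (auto simp: automorphism_def)
qed

lemma automorphism_alternating_class:
  assumes "automorphism D f" "pair_wf_digraph D"
    and "e' \<in> alternating_class D e"
  shows "map_prod f f e' \<in> alternating_class D (map_prod f f e)"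
proof -
  interpret pair_wf_digraph D by fact
  have arcs: "(f u, f v) \<in> parcs D" if "(u, v) \<in> parcs D" for u v
    using assms(1) that in_arcsD1[OF that] in_arcsD2[OF that] by (auto simp: automorphism_def)
  have verts: "f v \<in> pverts D" if "v \<in> pverts D" for v
    using assms(1) that by (auto simp: automorphism_def bij_betw_def)
  obtain b p where p: "alternating_walk D b p" "length p \<ge> 2"
      "walk_arc b p 0 = e" "walk_arc b p (length p - 2) = e'"
    using assms(3) by (auto simp: alternating_class_def alternating_related_def)
  have "alternating_walk D b (map f p)"
    using p(1) verts arcs by (auto simp: alternating_walk_def)
  moreover have "walk_arc b (map f p) j = map_prod f f (walk_arc b p j)"
    if "j + 1 < length p" for j
    using that by (auto simp: walk_arc_def)
  ultimately have "alternating_related D (map_prod f f e) (map_prod f f e')"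
    unfolding alternating_related_def using p
    by (intro exI[of _ b] exI[of _ "map f p"]) auto
  moreover have "map_prod f f e' \<in> parcs D"
    using assms(3) arcs by (cases e') (auto simp: alternating_class_def)
  ultimately show ?thesis by (simp add: alternating_class_def)
qed

lemma automorphism_alternating_class_eq:
  assumes f: "automorphism D f" and wf: "pair_wf_digraph D" and e: "e \<in> parcs D"
  shows "alternating_class D (map_prod f f e) = map_prod f f ` alternating_class D e"
proof
  show "map_prod f f ` alternating_class D e \<subseteq> alternating_class D (map_prod f f e)"
    by (intro image_subsetI) (rule automorphism_alternating_class[OF f wf])
next
  interpret pair_wf_digraph D by (rule wf)
  let ?g = "inv_into (pverts D) f"
  have b: "bij_betw f (pverts D) (pverts D)" using f by (simp add: automorphism_def)
  have gf: "map_prod ?g ?g (map_prod f f e) = e"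
    using e in_arcsD1[of "fst e" "snd e"] in_arcsD2[of "fst e" "snd e"]
    by (simp add: prod_eq_iff bij_betw_inv_into_left[OF b])
  show "alternating_class D (map_prod f f e) \<subseteq> map_prod f f ` alternating_class D e"
  proof
    fix x assume x: "x \<in> alternating_class D (map_prod f f e)"
    have "map_prod ?g ?g x \<in> alternating_class D e"
      using automorphism_alternating_class[OF automorphism_inv[OF f] wf x] gf by simp
    moreover have "map_prod f f (map_prod ?g ?g x) = x"
      using x in_arcsD1[of "fst x" "snd x"] in_arcsD2[of "fst x" "snd x"]
      by (simp add: alternating_class_def prod_eq_iff bij_betw_inv_into_right[OF b])
    ultimately show "x \<in> map_prod f f ` alternating_class D e"
      by (metis imageI)
  qed
qed

lemma reachability_digraph_iso:
  assumes wf: "pair_wf_digraph D" and tr: "s_arc_transitive D 1" and e: "e \<in> parcs D"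
  shows "digraph_iso (with_proj (reachability_digraph D))
           (with_proj (digraph_of_arcs (alternating_class D e)))"
proof -
  interpret pair_wf_digraph D by (rule wf)
  define d where "d = (SOME e. e \<in> parcs D)"
  have d: "d \<in> parcs D" unfolding d_def using e by (rule someI)
  have s1: "s_arc D 1 [fst x, snd x]" if "x \<in> parcs D" for x
    using that by (cases x) (auto simp: s_arc_def dest: in_arcsD1 in_arcsD2)
  obtain f where f: "automorphism D f" "map f [fst d, snd d] = [fst e, snd e]"
  proof -
    have "\<forall>p q. s_arc D 1 p \<and> s_arc D 1 q \<longrightarrow> (\<exists>f. automorphism D f \<and> map f p = q)"
      using tr unfolding s_arc_transitive_def by (elim conjE)
    with s1[OF d] s1[OF e] that show ?thesis by metis
  qed
  have fd: "map_prod f f d = e" using f(2) by (cases d, cases e) auto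
  let ?C = "alternating_class D d"
  have cls: "alternating_class D e = map_prod f f ` ?C"
    using automorphism_alternating_class_eq[OF f(1) wf d] fd by simp
  have inj: "inj_on f (pverts D)" using f(1) by (auto simp: automorphism_def bij_betw_def)
  have sub: "?C \<subseteq> pverts D \<times> pverts D"
    by (auto simp: alternating_class_def dest: in_arcsD1 in_arcsD2)
  have i1: "inj_on f (fst ` ?C \<union> snd ` ?C)"
    using sub by (intro inj_on_subset[OF inj]) auto
  have i2: "inj_on (map_prod f f) ?C"
    by (rule inj_on_subset[OF map_prod_inj_on[OF inj inj] sub])
  let ?h = "\<lparr>iso_verts = f, iso_arcs = map_prod f f, iso_head = snd, iso_tail = fst\<rparr>"
  let ?G = "with_proj (digraph_of_arcs ?C)"
  have "pre_digraph.digraph_isomorphism ?G ?h"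
    unfolding pre_digraph.digraph_isomorphism_def
    using i1 i2 by (auto simp: digraph_of_arcs_def wf_digraph_def)
  moreover have "with_proj (digraph_of_arcs (alternating_class D e)) = app_iso ?h ?G"
    by (simp add: cls digraph_of_arcs_def app_iso_def with_proj_def image_Un image_image)
  ultimately show ?thesis
    unfolding digraph_iso_def reachability_digraph_def d_def[symmetric] by blast
qed


section \<open>Complete bipartite digraphs\<close>

text \<open>
  Unlike the library's \<open>complete_bipartite_digraph\<close>, which is finite and symmetric, all arcs here
  go from the first part to the second, and the parts may be infinite.
\<close>

definition complete_bipartite :: "'v set \<Rightarrow> 'v set \<Rightarrow> 'v pair_pre_digraph" where
  "complete_bipartite X Y = \<lparr>pverts = X \<union> Y, parcs = X \<times> Y\<rparr>"

definition is_complete_bipartite :: "'v pair_pre_digraph \<Rightarrow> bool" where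
  "is_complete_bipartite G \<longleftrightarrow> (\<exists>X Y. X \<inter> Y = {} \<and> G = complete_bipartite X Y)"


section \<open>The digraphs \<open>T\<close> and \<open>D\<close>\<close>

definition perfect_matching :: "'v pair_pre_digraph \<Rightarrow> ('v \<times> 'v) set \<Rightarrow> bool" where
  "perfect_matching G M \<longleftrightarrow> M \<subseteq> parcs G \<and>
     (\<forall>v\<in>pverts G. \<exists>!e. e \<in> M \<and> (v = fst e \<or> v = snd e))"

definition delete_arcs :: "'v pair_pre_digraph \<Rightarrow> ('v \<times> 'v) set \<Rightarrow> 'v pair_pre_digraph" where
  "delete_arcs G M = \<lparr>pverts = pverts G, parcs = parcs G - M\<rparr>"

definition alternating_6_cycle :: "'v pair_pre_digraph \<Rightarrow> bool" where
  "alternating_6_cycle G \<longleftrightarrow> (\<exists>c :: nat \<Rightarrow> 'v. inj_on c {..<6} \<and> pverts G = c ` {..<6} \<and>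
     parcs G = (\<Union>i\<in>{i. i < 6 \<and> even i}. {(c i, c ((i + 1) mod 6)), (c i, c ((i + 5) mod 6))}))"

definition layered_digraph ::
    "'v set \<Rightarrow> 'v set \<Rightarrow> 'v pair_pre_digraph \<Rightarrow> (int \<times> 'v \<times> 'v) pair_pre_digraph" where
  "layered_digraph A1 A2 T =
     \<lparr>pverts = UNIV \<times> A1 \<times> A2,
      parcs = {((i, a1, a2), (i + 1, b1, b2)) | i a1 a2 b1 b2.
        a1 \<in> A1 \<and> a2 \<in> A2 \<and> b1 \<in> A1 \<and> b2 \<in> A2 \<and> (a1, b2) \<in> parcs T}\<rparr>"


section \<open>The conjecture of Cameron, Praeger and Wormald\<close>

text \<open>
  HOL cannot quantify over types inside a formula, so the conjecture is stated for digraphs whose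
  vertices are drawn from a given type. A connected highly arc-transitive digraph with a homomorphism
  to the line with one finite fibre has only countably many vertices, so any infinite type
  captures the full conjecture.
\<close>

definition cameron_praeger_wormald_conjecture :: "'v itself \<Rightarrow> bool" where
  "cameron_praeger_wormald_conjecture (_ :: 'v itself) \<longleftrightarrow>
     (\<forall>D :: 'v pair_pre_digraph.
        pair_loopfree_digraph D \<and>
        Digraph_Component.connected (with_proj D) \<and>
        highly_arc_transitive D \<and>
        (\<exists>f. digraph_hom f D directed_line \<and> finite {v \<in> pverts D. f v = 0}) \<longrightarrow>
        is_complete_bipartite (reachability_digraph D))"

end

theory Submission
  imports Defs "HOL-Combinatorics.Permutations"
begin

text \<open>
  A perfect matching between \<open>A1\<close> and \<open>A2\<close> is the graph of a bijection \<open>mu\<close>, so that the arcs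
  of \<open>D\<close> are the pairs \<open>(i, a1, a2) \<rightarrow> (i + 1, b1, b2)\<close> with \<open>b2 \<noteq> mu a1\<close>. Thus the second
  coordinates in layer \<open>i + 1\<close> interact only with the first coordinates in layer \<open>i\<close>. Between any
  two consecutive layers one may therefore choose a permutation of \<open>A1\<close>, let it act on the first
  coordinates of the lower layer and, transported along \<open>mu\<close>, on the second coordinates of the
  upper layer. All these choices are independent, and together with a translation they form an
  automorphism of \<open>D\<close> (\<open>automorphism_layer_map\<close>).

  For this reason high arc-transitivity reduces to a statement about one gap between layers.
  An \<open>s\<close>-arc prescribes, in each gap, at most a pair of distinct elements of \<open>A1\<close>: the first
  coordinate of its lower vertex and the \<open>mu\<close>-preimage of the second coordinate of its upper
  vertex. The symmetric group acts transitively on such pairs (\<open>permutation_on_pair\<close>), so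
  any \<open>s\<close>-arc can be moved to any other, gap by gap (\<open>s_arc_moves\<close>).

  Connectedness holds because two vertices of one layer always have a common out-neighbour
  when \<open>A1\<close> has at least three elements, and arcs link consecutive layers. The digraph \<open>R(D)\<close>
  is not complete bipartite because an alternating walk with three arcs can start in \<open>(i, a1, a2)\<close>
  and end in \<open>(i + 1, b1, mu a1)\<close>: those two vertices lie on opposite sides of one class
  but are not joined by an arc. The homomorphism to the line is the projection to the layer, whose
  fibres are copies of \<open>A1 \<times> A2\<close>.

  The construction is carried out for a bijection between finite parts of any size from three
  on; size three is the case in which the complement of the matching is a hexagon
  (\<open>alternating_6_cycle_T\<close>).
\<close>

lemma obtain_avoiding_two:
  assumes "card S \<ge> 3"
  obtains c where "c \<in> S" "c \<noteq> x" "c \<noteq> y"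
proof -
  have "card {x, y} \<le> 2" by (simp add: card_insert_if)
  then have "\<not> S \<subseteq> {x, y}" using assms card_mono[of "{x, y}" S] by fastforce
  then show ?thesis using that by blast
qed


section \<open>Permutations with prescribed values\<close>

lemma permutation_on_point:
  assumes "x \<in> A" "x' \<in> A"
  obtains \<pi> where "\<pi> permutes A" "\<pi> x = x'"
  using permutes_swap_id[OF assms] by (metis transpose_apply_first)

lemma permutation_on_pair:
  assumes A: "x \<in> A" "y \<in> A" "x' \<in> A" "y' \<in> A" and neq: "x \<noteq> y" "x' \<noteq> y'"
  obtains \<pi> where "\<pi> permutes A" "\<pi> x = x'" "\<pi> y = y'"
proof -
  let ?t = "transpose x x'"
  have t: "?t permutes A" using A(1,3) by (rule permutes_swap_id)
  then have z: "?t y \<in> A" using A(2) permutes_in_image by metis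
  \<comment> \<open>The second transposition leaves \<open>x'\<close> alone, as neither of its two points is \<open>x'\<close>.\<close>
  have "?t y \<noteq> x'" using neq(1) by (metis transpose_apply_first transpose_eq_imp_eq)
  then have "(transpose (?t y) y' \<circ> ?t) x = x'" using neq(2) by (simp add: transpose_apply_other)
  moreover have "(transpose (?t y) y' \<circ> ?t) permutes A"
    using t permutes_swap_id[OF z A(4)] by (rule permutes_compose)
  moreover have "(transpose (?t y) y' \<circ> ?t) y = y'" by simp
  ultimately show ?thesis using that by blast
qed


section \<open>The layered digraph of the complement of a matching\<close>

locale matching_complement =
  fixes A B :: "'a set" and mu :: "'a \<Rightarrow> 'a"
  assumes bij: "bij_betw mu A B" and card_A: "card A \<ge> 3"
begin

definition T :: "'a pair_pre_digraph" where
  "T = \<lparr>pverts = A \<union> B, parcs = {(a, b). a \<in> A \<and> b \<in> B \<and> b \<noteq> mu a}\<rparr>"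

definition D :: "(int \<times> 'a \<times> 'a) pair_pre_digraph" where
  "D = layered_digraph A B T"

abbreviation nu :: "'a \<Rightarrow> 'a" where "nu \<equiv> inv_into A mu"

lemma mu_in [simp]: "a \<in> A \<Longrightarrow> mu a \<in> B"
  using bij by (auto simp: bij_betw_def)

lemma nu_in [simp]: "b \<in> B \<Longrightarrow> nu b \<in> A"
  using bij_betw_inv_into[OF bij] by (auto simp: bij_betw_def)

lemma mu_nu [simp]: "b \<in> B \<Longrightarrow> mu (nu b) = b"
  using bij by (rule bij_betw_inv_into_right)

lemma nu_mu [simp]: "a \<in> A \<Longrightarrow> nu (mu a) = a"
  using bij by (rule bij_betw_inv_into_left)

lemma mu_eq_iff [simp]: "a \<in> A \<Longrightarrow> a' \<in> A \<Longrightarrow> mu a = mu a' \<longleftrightarrow> a = a'"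
  by (metis nu_mu)

lemma finite_A: "finite A"
  using card_A by (intro card_ge_0_finite) simp

lemma finite_B: "finite B"
  using finite_A bij bij_betw_finite by blast

lemma card_B: "card B \<ge> 3"
  using card_A bij_betw_same_card[OF bij] by simp

lemma pverts_D [simp]: "pverts D = UNIV \<times> A \<times> B"
  by (simp add: D_def layered_digraph_def)

lemma arc_D_iff [simp]:
  "((i, a1, a2), (j, b1, b2)) \<in> parcs D \<longleftrightarrow>
     j = i + 1 \<and> a1 \<in> A \<and> a2 \<in> B \<and> b1 \<in> A \<and> b2 \<in> B \<and> b2 \<noteq> mu a1"
  by (auto simp: D_def T_def layered_digraph_def)

lemma nonempty: "A \<noteq> {}" "B \<noteq> {}"
  using card_A card_B by auto

lemma loopfree_D: "pair_loopfree_digraph D"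
  by unfold_locales auto

lemma hom_D: "digraph_hom fst D directed_line"
  by (auto simp: digraph_hom_directed_line_iff)

lemma finite_fibre_D: "finite {v \<in> pverts D. fst v = i}"
proof (rule finite_subset)
  show "{v \<in> pverts D. fst v = i} \<subseteq> {i} \<times> A \<times> B" by auto
  show "finite ({i} \<times> A \<times> B)" using finite_A finite_B by simp
qed


section \<open>Connectedness\<close>

abbreviation (input) joined (infix "\<leftrightarrow>" 50) where
  "u \<leftrightarrow> v \<equiv> reachable (mk_symmetric (with_proj D)) u v"

lemma joined_arc:
  assumes "(u, v) \<in> parcs D" shows "u \<leftrightarrow> v" "v \<leftrightarrow> u"
proof -
  interpret D: pair_loopfree_digraph D by (rule loopfree_D)
  interpret S: pair_wf_digraph "mk_symmetric (with_proj D)" by (rule D.wellformed_mk_symmetric)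
  have "(u, v) \<in> parcs (mk_symmetric (with_proj D))" "(v, u) \<in> parcs (mk_symmetric (with_proj D))"
    unfolding parcs_mk_symmetric using assms by (intro UN_I[of "(u, v)"]; simp)+
  then show "u \<leftrightarrow> v" "v \<leftrightarrow> u" by (simp_all add: S.reachable_adjI)
qed

lemma joined_trans: "u \<leftrightarrow> v \<Longrightarrow> v \<leftrightarrow> w \<Longrightarrow> u \<leftrightarrow> w"
proof -
  interpret D: pair_loopfree_digraph D by (rule loopfree_D)
  interpret S: pair_wf_digraph "mk_symmetric (with_proj D)" by (rule D.wellformed_mk_symmetric)
  show "u \<leftrightarrow> v \<Longrightarrow> v \<leftrightarrow> w \<Longrightarrow> u \<leftrightarrow> w" by (rule S.reachable_trans)
qed

lemma joined_sym: "u \<leftrightarrow> v \<Longrightarrow> v \<leftrightarrow> u"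
  by (rule symmetric_reachable[OF symmetric_mk_symmetric])

text \<open>
  The out-neighbourhoods of two vertices in one layer each miss a single second coordinate, so they
  meet.
\<close>

lemma joined_same_layer:
  assumes "a \<in> A" "b \<in> B" "a' \<in> A" "b' \<in> B"
  shows "(i, a, b) \<leftrightarrow> (i, a', b')"
proof -
  obtain c where c: "c \<in> B" "c \<noteq> mu a" "c \<noteq> mu a'"
    using card_B by (rule obtain_avoiding_two)
  have "(i, a, b) \<leftrightarrow> (i + 1, a, c)" using assms c by (intro joined_arc) simp
  moreover have "(i + 1, a, c) \<leftrightarrow> (i, a', b')" using assms c by (intro joined_arc) simp
  ultimately show ?thesis by (rule joined_trans)
qed

lemma joined_higher_layer:
  assumes "a \<in> A" "b \<in> B" "a' \<in> A" "b' \<in> B"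
  shows "(i, a, b) \<leftrightarrow> (i + int n, a', b')"
  using assms(3,4)
proof (induction n arbitrary: a' b')
  case 0
  then show ?case using assms joined_same_layer by simp
next
  case (Suc n)
  obtain c where c: "c \<in> A" "c \<noteq> nu b'"
    using card_A by (rule obtain_avoiding_two)
  then have "b' \<noteq> mu c" using nu_mu by auto
  then have "(i + int n, c, b) \<leftrightarrow> (i + int (Suc n), a', b')"
    using Suc.prems assms c by (intro joined_arc) simp
  then show ?case using Suc.IH[OF c(1) assms(2)] joined_trans by blast
qed

lemma connected_D: "Digraph_Component.connected (with_proj D)"
  unfolding Digraph_Component.connected_def
proof (rule strongly_connectedI)
  show "verts (with_proj (mk_symmetric (with_proj D))) \<noteq> {}" using nonempty by simp
next
  fix u v
  assume "u \<in> verts (with_proj (mk_symmetric (with_proj D)))"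
    "v \<in> verts (with_proj (mk_symmetric (with_proj D)))"
  then have uv: "u \<in> UNIV \<times> A \<times> B" "v \<in> UNIV \<times> A \<times> B" by simp_all
  obtain i a b j a' b' where eq: "u = (i, a, b)" "v = (j, a', b')" by (metis prod_cases3)
  show "u \<leftrightarrow> v"
  proof (cases "i \<le> j")
    case True
    then show ?thesis using joined_higher_layer[of a b a' b' i "nat (j - i)"] uv eq by simp
  next
    case False
    then show ?thesis
      using joined_higher_layer[of a' b' a b j "nat (i - j)"] uv eq joined_sym by simp
  qed
qed


section \<open>High arc-transitivity\<close>

text \<open>
  The permutation \<open>\<sigma> i\<close> belongs to the gap between the layers \<open>i\<close> and \<open>i + 1\<close>; this is why
  the second coordinate of a vertex in layer \<open>i\<close> is moved by \<open>\<sigma> (i - 1)\<close>.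
\<close>

definition layer_map :: "int \<Rightarrow> (int \<Rightarrow> 'a \<Rightarrow> 'a) \<Rightarrow> int \<times> 'a \<times> 'a \<Rightarrow> int \<times> 'a \<times> 'a" where
  "layer_map k \<sigma> = (\<lambda>(i, a, b). (i + k, \<sigma> i a, mu (\<sigma> (i - 1) (nu b))))"

lemma automorphism_layer_map:
  assumes \<sigma>: "\<And>i. \<sigma> i permutes A"
  shows "automorphism D (layer_map k \<sigma>)"
proof -
  have in_A [simp]: "\<sigma> i a \<in> A \<longleftrightarrow> a \<in> A" for i a
    using \<sigma> by (rule permutes_in_image)
  have eq_iff [simp]: "\<sigma> i a = \<sigma> i a' \<longleftrightarrow> a = a'" for i a a'
    using permutes_inj[OF \<sigma>] by (auto dest: injD)
  have inv_in [simp]: "inv (\<sigma> i) a \<in> A \<longleftrightarrow> a \<in> A" for i a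
    using permutes_inv[OF \<sigma>] by (rule permutes_in_image)
  have invs [simp]: "\<sigma> i (inv (\<sigma> i) a) = a" "inv (\<sigma> i) (\<sigma> i a) = a" for i a
    using permutes_inverses[OF \<sigma>] by auto
  have "bij_betw (layer_map k \<sigma>) (pverts D) (pverts D)"
    by (rule bij_betw_byWitness[where f' = "layer_map (- k) (\<lambda>i. inv (\<sigma> (i - k)))"])
      (auto simp: layer_map_def algebra_simps)
  moreover have "(u, v) \<in> parcs D \<longleftrightarrow> (layer_map k \<sigma> u, layer_map k \<sigma> v) \<in> parcs D"
    if uv: "u \<in> pverts D" "v \<in> pverts D" for u v
  proof -
    obtain i a b j a' b' where eq: "u = (i, a, b)" "v = (j, a', b')" by (metis prod_cases3)
    have "b' = mu a \<longleftrightarrow> nu b' = a" using uv eq by auto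
    then show ?thesis using uv eq by (auto simp: layer_map_def)
  qed
  ultimately show ?thesis by (simp add: automorphism_def)
qed

text \<open>
  Replacing second coordinates by their \<open>mu\<close>-preimages turns an \<open>s\<close>-arc into its initial layer
  and two sequences in \<open>A\<close>, whose only interaction is one inequality in each gap.
\<close>

lemma s_arcE:
  assumes "s_arc D s p"
  obtains i x y where "\<And>j. j \<le> s \<Longrightarrow> p ! j = (i + int j, x j, mu (y j))"
    and "\<And>j. j \<le> s \<Longrightarrow> x j \<in> A" and "\<And>j. j \<le> s \<Longrightarrow> y j \<in> A"
    and "\<And>j. j < s \<Longrightarrow> x j \<noteq> y (Suc j)"
proof -
  define x where "x j = fst (snd (p ! j))" for j
  define y where "y j = nu (snd (snd (p ! j)))" for j
  have vert: "p ! j \<in> UNIV \<times> A \<times> B" if "j \<le> s" for j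
    using assms that pverts_D unfolding s_arc_def by (metis Suc_eq_plus1 le_imp_less_Suc nth_mem subsetD)
  have arc: "(p ! j, p ! Suc j) \<in> parcs D" if "j < s" for j
    using assms that unfolding s_arc_def by (auto dest: bspec[where x = "Suc j"])
  have step: "fst (p ! Suc j) = fst (p ! j) + 1" "x j \<noteq> y (Suc j)" if "j < s" for j
    using arc[OF that] by (cases "p ! j"; cases "p ! Suc j"; auto simp: x_def y_def)+
  have layer: "fst (p ! j) = fst (p ! 0) + int j" if "j \<le> s" for j
    using that by (induction j) (auto simp: step)
  have "p ! j = (fst (p ! 0) + int j, x j, mu (y j))" if "j \<le> s" for j
    using vert[OF that] layer[OF that] by (auto simp: x_def y_def prod_eq_iff)
  moreover have "x j \<in> A" "y j \<in> A" if "j \<le> s" for j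
    using vert[OF that] by (auto simp: x_def y_def)
  ultimately show ?thesis using step(2) that by blast
qed

text \<open>
  The gaps can be treated one at a time. A gap between two vertices of the \<open>s\<close>-arcs imposes
  two conditions on its permutation, the gaps just below and just above the \<open>s\<close>-arcs impose one,
  and all others none.
\<close>

lemma s_arc_moves:
  assumes p: "s_arc D s p" and q: "s_arc D s q"
  obtains f where "automorphism D f" "map f p = q"
proof -
  obtain i x y where p_nth: "\<And>j. j \<le> s \<Longrightarrow> p ! j = (i + int j, x j, mu (y j))"
    and x: "\<And>j. j \<le> s \<Longrightarrow> x j \<in> A" and y: "\<And>j. j \<le> s \<Longrightarrow> y j \<in> A"
    and xy: "\<And>j. j < s \<Longrightarrow> x j \<noteq> y (Suc j)"
    using p by (rule s_arcE) blast
  obtain i' x' y' where q_nth: "\<And>j. j \<le> s \<Longrightarrow> q ! j = (i' + int j, x' j, mu (y' j))"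
    and x': "\<And>j. j \<le> s \<Longrightarrow> x' j \<in> A" and y': "\<And>j. j \<le> s \<Longrightarrow> y' j \<in> A"
    and xy': "\<And>j. j < s \<Longrightarrow> x' j \<noteq> y' (Suc j)"
    using q by (rule s_arcE) blast
  have "\<exists>\<pi>. \<pi> permutes A \<and> (\<forall>j\<le>s. n = i + int j \<longrightarrow> \<pi> (x j) = x' j) \<and>
          (\<forall>j\<le>s. n = i + int j - 1 \<longrightarrow> \<pi> (y j) = y' j)" for n
  proof -
    consider "n < i - 1 \<or> n > i + int s" | "n = i - 1" | "n = i + int s"
      | j where "j < s" "n = i + int j"
    proof (cases "i \<le> n \<and> n < i + int s")
      case True
      then have "nat (n - i) < s" "n = i + int (nat (n - i))" by auto
      then show ?thesis by (rule that(4))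
    qed (use that in linarith)
    then show ?thesis
    proof cases
      case 1
      then show ?thesis using permutes_id[of A] by (intro exI[of _ id]) auto
    next
      case 2
      obtain \<pi> where "\<pi> permutes A" "\<pi> (y 0) = y' 0"
        using permutation_on_point[OF y[of 0] y'[of 0]] by blast
      then show ?thesis using 2 by (intro exI[of _ \<pi>]) auto
    next
      case 3
      obtain \<pi> where "\<pi> permutes A" "\<pi> (x s) = x' s"
        using permutation_on_point[OF x[of s] x'[of s]] by blast
      then show ?thesis using 3 by (intro exI[of _ \<pi>]) auto
    next
      case 4
      then have "x j \<in> A" "y (Suc j) \<in> A" "x' j \<in> A" "y' (Suc j) \<in> A"
        and "x j \<noteq> y (Suc j)" "x' j \<noteq> y' (Suc j)"
        using x[of j] x'[of j] y[of "Suc j"] y'[of "Suc j"] xy[of j] xy'[of j] by simp_all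
      then obtain \<pi> where \<pi>: "\<pi> permutes A" "\<pi> (x j) = x' j" "\<pi> (y (Suc j)) = y' (Suc j)"
        by (rule permutation_on_pair)
      have "k = j" if "n = i + int k" for k using that 4 by simp
      moreover have "k = Suc j" if "n = i + int k - 1" for k using that 4 by simp
      ultimately show ?thesis using \<pi> by (intro exI[of _ \<pi>]) blast
    qed
  qed
  then obtain \<sigma> where \<sigma>: "\<And>n. \<sigma> n permutes A"
    and \<sigma>x: "\<And>j. j \<le> s \<Longrightarrow> \<sigma> (i + int j) (x j) = x' j"
    and \<sigma>y: "\<And>j. j \<le> s \<Longrightarrow> \<sigma> (i + int j - 1) (y j) = y' j"
    by metis
  have "map (layer_map (i' - i) \<sigma>) p = q"
  proof (rule nth_equalityI)
    show "length (map (layer_map (i' - i) \<sigma>) p) = length q" using p q by (simp add: s_arc_def)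
  next
    fix j assume "j < length (map (layer_map (i' - i) \<sigma>) p)"
    then have "j < length p" "j \<le> s" using p by (simp_all add: s_arc_def)
    then show "map (layer_map (i' - i) \<sigma>) p ! j = q ! j"
      using \<sigma>x[of j] \<sigma>y[of j] y[of j] by (simp add: p_nth q_nth layer_map_def)
  qed
  with automorphism_layer_map[OF \<sigma>] show ?thesis by (rule that)
qed

lemma no_isolated_vertices_D: "no_isolated_vertices D"
  unfolding no_isolated_vertices_def
proof
  fix v assume v: "v \<in> pverts D"
  obtain i a b where eq: "v = (i, a, b)" by (metis prod_cases3)
  obtain c where "c \<in> B" "c \<noteq> mu a" using card_B by (rule obtain_avoiding_two)
  then have "(i + 1, a, c) \<in> pverts D" "(v, (i + 1, a, c)) \<in> parcs D" using v eq by auto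
  then show "\<exists>u\<in>pverts D. (u, v) \<in> parcs D \<or> (v, u) \<in> parcs D" by blast
qed

text \<open>
  An arc is prolonged from its head by keeping the first coordinate and using the same admissible
  second coordinate in all later layers.
\<close>

lemma arc_on_s_arc:
  assumes e: "e \<in> parcs D" and s: "s \<ge> 1"
  obtains p where "s_arc D s p" "e = (p ! 0, p ! 1)"
proof -
  obtain i a1 a2 j b1 b2 where "e = ((i, a1, a2), (j, b1, b2))" by (metis prod.exhaust)
  then have eq: "e = ((i, a1, a2), (i + 1, b1, b2))"
    and arc: "a1 \<in> A" "a2 \<in> B" "b1 \<in> A" "b2 \<in> B" "b2 \<noteq> mu a1"
    using e by auto
  obtain c where c: "c \<in> B" "c \<noteq> mu b1" using card_B by (rule obtain_avoiding_two)
  define g where "g n = (i + int n, if n = 0 then a1 else b1,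
    if n = 0 then a2 else if n = 1 then b2 else c)" for n :: nat
  have vert: "g n \<in> pverts D" for n using arc c by (simp add: g_def)
  have step: "(g (n - 1), g n) \<in> parcs D" if "n \<ge> 1" for n
    using that arc c by (auto simp: g_def)
  let ?p = "map g [0..<s + 1]"
  have nth: "?p ! n = g n" if "n \<le> s" for n
    using that nth_map_upt[of n "s + 1" 0 g] by simp
  have "(?p ! (n - 1), ?p ! n) \<in> parcs D" if "n \<in> {1..s}" for n
  proof -
    have "n - 1 \<le> s" "n \<le> s" "n \<ge> 1" using that by auto
    then show ?thesis using step[of n] by (simp only: nth)
  qed
  moreover have "set ?p \<subseteq> pverts D" using vert by (auto simp del: pverts_D upt_Suc)
  ultimately have "s_arc D s ?p" unfolding s_arc_def by simp
  moreover have "e = (?p ! 0, ?p ! 1)" using s by (simp add: nth eq g_def del: upt_Suc)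
  ultimately show ?thesis by (rule that)
qed

lemma highly_arc_transitive_D: "highly_arc_transitive D"
  unfolding highly_arc_transitive_def s_arc_transitive_def
proof (intro allI conjI impI ballI)
  fix s :: nat and e assume s: "1 \<le> s" and "e \<in> parcs D"
  then obtain p where "s_arc D s p" "e = (p ! 0, p ! 1)" using arc_on_s_arc by blast
  then show "\<exists>p. s_arc D s p \<and> (\<exists>i\<in>{1..s}. e = (p ! (i - 1), p ! i))"
    using s by (intro exI[of _ p] conjI bexI[of _ 1]) auto
next
  fix s p q assume "s_arc D s p \<and> s_arc D s q"
  then show "\<exists>f. automorphism D f \<and> map f p = q" using s_arc_moves by blast
qed (rule no_isolated_vertices_D)


section \<open>The reachability digraph\<close>

text \<open>
  For an arc \<open>u \<rightarrow> v\<close> there are arcs \<open>v \<leftarrow> u' \<rightarrow> v'\<close> such that \<open>u \<rightarrow> v'\<close> is not an arc: the second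
  coordinate of \<open>v'\<close> is the partner of the first coordinate of \<open>u\<close>. Choosing \<open>u'\<close>
  requires a first coordinate different from two given ones.
\<close>

lemma alternating_class_not_product:
  assumes e: "e \<in> parcs D"
  shows "alternating_class D e \<noteq> X \<times> Y"
proof
  assume prod: "alternating_class D e = X \<times> Y"
  obtain i a1 a2 j b1 b2 where "e = ((i, a1, a2), (j, b1, b2))" by (metis prod.exhaust)
  then have eq: "e = ((i, a1, a2), (i + 1, b1, b2))"
    and arc: "a1 \<in> A" "a2 \<in> B" "b1 \<in> A" "b2 \<in> B" "b2 \<noteq> mu a1"
    using e by auto
  obtain c where c: "c \<in> A" "c \<noteq> a1" "c \<noteq> nu b2" using card_A by (rule obtain_avoiding_two)
  then have cb: "b2 \<noteq> mu c" by auto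
  let ?u = "(i, a1, a2)" and ?v = "(i + 1, b1, b2)"
    and ?u' = "(i, c, a2)" and ?v' = "(i + 1, b1, mu a1)"
  have "alternating_walk D True [?u, ?v, ?u', ?v']"
    unfolding alternating_walk_def using arc c cb
    by (simp add: All_less_Suc)
  then have "alternating_related D e (?u', ?v')"
    unfolding alternating_related_def
    by (intro exI[of _ True] exI[of _ "[?u, ?v, ?u', ?v']"]) (simp add: walk_arc_def eq)
  then have "(?u', ?v') \<in> X \<times> Y"
    using arc c unfolding prod[symmetric] by (simp add: alternating_class_def)
  moreover have "alternating_walk D True [?u, ?v]"
    unfolding alternating_walk_def using arc by (simp add: All_less_Suc)
  then have "alternating_related D e e"
    unfolding alternating_related_def
    by (intro exI[of _ True] exI[of _ "[?u, ?v]"]) (simp add: walk_arc_def eq)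
  then have "(?u, ?v) \<in> X \<times> Y"
    using e unfolding prod[symmetric] by (simp add: alternating_class_def eq)
  ultimately have "(?u, ?v') \<in> alternating_class D e" unfolding prod by blast
  then show False by (simp add: alternating_class_def)
qed

lemma not_complete_bipartite_D: "\<not> is_complete_bipartite (reachability_digraph D)"
proof -
  let ?e = "SOME e. e \<in> parcs D"
  obtain a where "a \<in> A" using nonempty by blast
  moreover obtain b where "b \<in> B" "b \<noteq> mu a" using card_B by (rule obtain_avoiding_two)
  ultimately have "((0, a, b), (1, a, b)) \<in> parcs D" by simp
  then have "?e \<in> parcs D" by (rule someI)
  then show ?thesis
    using alternating_class_not_product
    by (auto simp: is_complete_bipartite_def reachability_digraph_def digraph_of_arcs_def
        complete_bipartite_def)
qed


section \<open>The shape of \<open>T\<close>\<close>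

text \<open>
  With three elements \<open>x0\<close>, \<open>x1\<close>, \<open>x2\<close> in \<open>A\<close>, opposite vertices of the hexagon are partners
  under \<open>mu\<close>; every other pair from \<open>A \<times> B\<close> is adjacent on it.
\<close>

lemma alternating_6_cycle_T:
  assumes "card A = 3" and disj: "A \<inter> B = {}"
  shows "alternating_6_cycle T"
proof -
  obtain x0 x1 x2 where A: "A = {x0, x1, x2}" and neq: "x0 \<noteq> x1" "x0 \<noteq> x2" "x1 \<noteq> x2"
    using \<open>card A = 3\<close> by (auto simp: card_3_iff)
  have B: "B = {mu x0, mu x1, mu x2}" using bij A by (auto simp: bij_betw_def)
  have mu_neq: "mu x0 \<noteq> mu x1" "mu x0 \<noteq> mu x2" "mu x1 \<noteq> mu x2"
    using neq A by auto
  have AB: "x \<noteq> mu y" if "x \<in> A" "y \<in> A" for x y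
    using that disj mu_in by blast
  have A_B_neq: "\<forall>x\<in>{x0, x1, x2}. \<forall>y\<in>{x0, x1, x2}. x \<noteq> mu y"
    using AB unfolding A by blast
  define c where "c n = [x0, mu x2, x1, mu x0, x2, mu x1] ! n" for n :: nat
  have c: "c 0 = x0" "c 1 = mu x2" "c (Suc 0) = mu x2" "c 2 = x1" "c 3 = mu x0" "c 4 = x2"
    "c 5 = mu x1"
    by (simp_all add: c_def)
  have six: "{..<6} = {0, 1, 2, 3, 4, 5 :: nat}" by auto
  have "i < 6 \<and> even i \<longleftrightarrow> i = 0 \<or> i = 2 \<or> i = 4" for i :: nat by presburger
  then have evens: "{i. i < 6 \<and> even i} = {0, 2, 4 :: nat}" by blast
  have "distinct [x0, mu x2, x1, mu x0, x2, mu x1]"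
    using neq mu_neq A_B_neq by auto
  then have "inj_on c {..<6}"
    unfolding c_def by (intro inj_on_nth) auto
  moreover have "pverts T = c ` {..<6}"
    unfolding six T_def by (auto simp: A B c)
  moreover have "parcs T =
      {(x0, mu x2), (x0, mu x1), (x1, mu x0), (x1, mu x2), (x2, mu x1), (x2, mu x0)}"
    unfolding T_def using neq mu_neq by (auto simp: A B)
  then have "parcs T =
      (\<Union>i\<in>{i. i < 6 \<and> even i}. {(c i, c ((i + 1) mod 6)), (c i, c ((i + 5) mod 6))})"
    unfolding evens by (auto simp: c)
  ultimately show ?thesis unfolding alternating_6_cycle_def by blast
qed

end


section \<open>Perfect matchings as bijections and the refutation\<close>

lemma perfect_matching_bijection:
  assumes M: "perfect_matching (complete_bipartite X Y) M" and disj: "X \<inter> Y = {}"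
  obtains mu where "bij_betw mu X Y" "M = {(x, mu x) | x. x \<in> X}"
proof -
  have sub: "M \<subseteq> X \<times> Y"
    and cover: "\<And>v. v \<in> X \<union> Y \<Longrightarrow> \<exists>!e. e \<in> M \<and> (v = fst e \<or> v = snd e)"
    using M by (auto simp: perfect_matching_def complete_bipartite_def)
  have "\<exists>y. (x, y) \<in> M" if x: "x \<in> X" for x
  proof -
    obtain e where "e \<in> M" "x = fst e \<or> x = snd e"
      using ex1_implies_ex[OF cover[of x]] x by blast
    then show ?thesis using x sub disj by (cases e) auto
  qed
  then obtain mu where mu: "\<And>x. x \<in> X \<Longrightarrow> (x, mu x) \<in> M" by metis
  have unique: "e = e'" if "v \<in> X \<union> Y" "e \<in> M" "v = fst e \<or> v = snd e"
    "e' \<in> M" "v = fst e' \<or> v = snd e'" for v e e'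
    using cover[OF that(1)] that(2-5) by (elim ex1E) metis
  have func: "y = y'" if "(x, y) \<in> M" "(x, y') \<in> M" for x y y'
    using unique[of x "(x, y)" "(x, y')"] that sub by auto
  have inj: "x = x'" if "(x, y) \<in> M" "(x', y) \<in> M" for x x' y
    using unique[of y "(x, y)" "(x', y)"] that sub by auto
  have graph: "M = {(x, mu x) | x. x \<in> X}"
  proof
    show "M \<subseteq> {(x, mu x) | x. x \<in> X}" using mu func sub by blast
    show "{(x, mu x) | x. x \<in> X} \<subseteq> M" using mu by blast
  qed
  have "\<exists>x. (x, y) \<in> M" if y: "y \<in> Y" for y
  proof -
    obtain e where "e \<in> M" "y = fst e \<or> y = snd e"
      using ex1_implies_ex[OF cover[of y]] y by blast
    then show ?thesis using y sub disj by (cases e) auto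
  qed
  then have "Y \<subseteq> mu ` X" using graph by blast
  moreover have "mu ` X \<subseteq> Y" using mu sub by blast
  moreover have "inj_on mu X" using mu inj by (metis inj_onI)
  ultimately have "bij_betw mu X Y" by (auto simp: bij_betw_def)
  then show ?thesis using graph by (rule that)
qed

lemma layered_digraph_properties:
  assumes card: "card A1 = 3" and disj: "A1 \<inter> A2 = {}"
    and M: "perfect_matching (complete_bipartite A1 A2) M"
    and T: "T = delete_arcs (complete_bipartite A1 A2) M" and D: "D = layered_digraph A1 A2 T"
  shows "alternating_6_cycle T" "pair_loopfree_digraph D"
    "Digraph_Component.connected (with_proj D)" "highly_arc_transitive D"
    "\<exists>f. digraph_hom f D directed_line \<and> finite {v \<in> pverts D. f v = 0}"
    "\<not> is_complete_bipartite (reachability_digraph D)"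
proof -
  obtain mu where mu: "bij_betw mu A1 A2" "M = {(x, mu x) | x. x \<in> A1}"
    using M disj by (rule perfect_matching_bijection)
  interpret L: matching_complement A1 A2 mu
    using mu(1) card by unfold_locales simp_all
  have T_eq: "T = L.T"
    unfolding T L.T_def mu(2) by (auto simp: delete_arcs_def complete_bipartite_def)
  have D_eq: "D = L.D" unfolding D L.D_def T_eq ..
  show "alternating_6_cycle T" unfolding T_eq using card disj by (rule L.alternating_6_cycle_T)
  show "pair_loopfree_digraph D" unfolding D_eq by (rule L.loopfree_D)
  show "Digraph_Component.connected (with_proj D)" unfolding D_eq by (rule L.connected_D)
  show "highly_arc_transitive D" unfolding D_eq by (rule L.highly_arc_transitive_D)
  show "\<exists>f. digraph_hom f D directed_line \<and> finite {v \<in> pverts D. f v = 0}"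
    unfolding D_eq using L.hom_D L.finite_fibre_D by blast
  show "\<not> is_complete_bipartite (reachability_digraph D)"
    unfolding D_eq by (rule L.not_complete_bipartite_D)
qed

lemma conjecture_false: "\<not> cameron_praeger_wormald_conjecture TYPE(int \<times> nat \<times> nat)"
proof -
  let ?A1 = "{0, 1, 2 :: nat}" and ?A2 = "{3, 4, 5 :: nat}"
  let ?K = "complete_bipartite ?A1 ?A2" and ?M = "{(0, 3), (1, 4), (2, 5 :: nat)}"
  have cover: "\<exists>!e. e \<in> ?M \<and> (v = fst e \<or> v = snd e)" if "v \<in> ?A1 \<union> ?A2" for v
    by (rule ex1I[of _ "(v mod 3, v mod 3 + 3)"]) (use that in auto)
  have "?M \<subseteq> ?A1 \<times> ?A2" by simp
  then have "perfect_matching ?K ?M"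
    unfolding perfect_matching_def complete_bipartite_def pair_pre_digraph.simps
    by (intro conjI ballI) (assumption, erule cover)
  note props = layered_digraph_properties(2-6)[OF _ _ this refl refl]
  show ?thesis
  proof
    assume "cameron_praeger_wormald_conjecture TYPE(int \<times> nat \<times> nat)"
    then have "is_complete_bipartite
      (reachability_digraph (layered_digraph ?A1 ?A2 (delete_arcs ?K ?M)))"
      unfolding cameron_praeger_wormald_conjecture_def using props(1-4) by simp
    then show False using props(5) by simp
  qed
qed

theorem mainTheorem2:
  shows "(\<forall>(A1 :: 'a set) A2 M T D.
            card A1 = 3 \<and> card A2 = 3 \<and> A1 \<inter> A2 = {} \<and>
            perfect_matching (complete_bipartite A1 A2) M \<and>
            T = delete_arcs (complete_bipartite A1 A2) M \<and>
            D = layered_digraph A1 A2 T \<longrightarrow>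
            alternating_6_cycle T \<and>
            pair_loopfree_digraph D \<and>
            Digraph_Component.connected (with_proj D) \<and>
            highly_arc_transitive D \<and>
            (\<exists>f. digraph_hom f D directed_line \<and> finite {v \<in> pverts D. f v = 0}) \<and>
            \<not> is_complete_bipartite (reachability_digraph D)) \<and>
         \<not> cameron_praeger_wormald_conjecture TYPE(int \<times> nat \<times> nat)"
proof (intro conjI)
  show "\<not> cameron_praeger_wormald_conjecture TYPE(int \<times> nat \<times> nat)" by (rule conjecture_false)
qed (intro allI impI conjI; elim conjE; rule layered_digraph_properties; assumption)

end
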